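(* Assume that the set $\{(q,u)\in\mathbb{R}^{TI}\times\{0,1\}^{TI}:G_iq_i+H_iu_i\leq h_i,\ A_iu_i\leq b_i,\ i=1,\dots,I\}$ is non-empty and bounded, and that there are concave and continuously differentiable functions $F_t:\mathbb{R}^I\to\mathbb{R}$, $t=1,\dots,T$, such that $F_t(q_{it},q_{-it})-F_t(x_i,q_{-it})=P_{it}(q_{it},q_{-it})-P_{it}(x_i,q_{-it})$ for all $q_t\in\mathbb{R}^{I}$, $x_i\in\mathbb{R}$, $t=1,\dots,T$ and $i=1,\dots,I$. Then there exists a unit commitment constrained Nash equilibrium.
   Context: Let $I,T,m,n$ be positive integers. There are $I$ producers, each operating one unit $i=1,\dots,I$ over time periods $t=1,\dots,T$. Producer $i$ chooses $q_i=(q_{i1},\dots,q_{iT})^\top\in\mathbb{R}^T$ and $u_i=(u_{i1},\dots,u_{iT})^\top\in\{0,1\}^T$. Write $q=(q_{it})$, $u=(u_{it})$, $q_t=(q_{1t},\dots,q_{It})^\top$, $q_{-it}=(q_{kt})_{k\neq i}$, $q_{-i}=(q_k)_{k\ne i}$; for a function of $q_t\in\mathbb{R}^I$, $(x_i,q_{-it})$ denotes $q_t$ with its $i$-th component replaced by $x_i$. Each $P_{it}:\mathbb{R}\times\mathbb{R}^{I-1}\to\mathbb{R}$ is a revenue function, concave and continuously differentiable in its first argument. For each $i$, $C_i:\mathbb{R}\to\mathbb{R}$ is convex and continuously differentiable, $S_i:\mathbb{R}^T\to\mathbb{R}$ is continuous, $A_i\in\mathbb{R}^{n\times T}$, $b_i\in\mathbb{R}^n$,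 $G_i,H_i\in\mathbb{R}^{m\times T}$, $h_i\in\mathbb{R}^m$. $(q_1,u_1,\dots,q_I,u_I)$ is a unit commitment constrained Nash equilibrium if for every $i=1,\dots,I$, given $q_{-i}$, the pair $(q_i,u_i)$ is an optimal solution to $$\max_{q_i,u_i}\Big\{\sum_{t=1}^TP_{it}(q_{it},q_{-it})-\sum_{t=1}^TC_i(q_{it})-S_i(u_i) : G_iq_i+H_iu_i\leq h_i,\ A_iu_i\leq b_i,\ u_i\in\{0,1\}^T\Big\}.$$ *)

theory Defs
  imports "HOL-Analysis.Analysis"
begin

text \<open>
  Finite index types: \<open>'i\<close> for producers, \<open>'t\<close> for time periods, \<open>'m\<close> and \<open>'n\<close> for the rows of the
  two constraint systems.  A profile \<open>q :: real^'t^'i\<close> has \<open>q $ i $ t\<close> as the quantity of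
  producer \<open>i\<close> in period \<open>t\<close>.
\<close>

text \<open>The one-dimensional notion is the library's \<open>C1_differentiable_on\<close>; this one is for
  functions of several variables.\<close>

definition continuously_differentiable ::
    "('a::real_normed_vector \<Rightarrow> 'b::real_normed_vector) \<Rightarrow> bool" where
  "continuously_differentiable f \<longleftrightarrow>
     (\<exists>f' :: 'a \<Rightarrow> 'a \<Rightarrow>\<^sub>L 'b. (\<forall>x. (f has_derivative blinfun_apply (f' x)) (at x)) \<and> continuous_on UNIV f')"

text \<open>\<open>replace_comp v i x\<close> is $(x, v_{-i})$.  A function on $R \times R^{I-1}$
  whose first argument is the \<open>i\<close>-th coordinate is represented as a function \<open>f\<close> of the full vector
  \<open>v :: real^'i\<close>, and its value at $(x, v_{-i})$ is \<open>f (replace_comp v i x)\<close>.\<close>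

definition replace_comp :: "real^'i \<Rightarrow> 'i \<Rightarrow> real \<Rightarrow> real^'i" where
  "replace_comp v i x = (\<chi> k. if k = i then x else v $ k)"

definition period :: "real^'t^'i \<Rightarrow> 't \<Rightarrow> real^'i" where
  "period q t = (\<chi> i. q $ i $ t)"

definition feasible_set ::
    "real^'t^'m \<Rightarrow> real^'t^'m \<Rightarrow> real^'m \<Rightarrow> real^'t^'n \<Rightarrow> real^'n \<Rightarrow> ((real^'t) \<times> (real^'t)) set" where
  "feasible_set G H h A b =
     {(x, w). G *v x + H *v w \<le> h \<and> A *v w \<le> b \<and> (\<forall>t. w $ t \<in> {0, 1})}"

definition joint_feasible_set ::
    "('i \<Rightarrow> real^'t^'m) \<Rightarrow> ('i \<Rightarrow> real^'t^'m) \<Rightarrow> ('i \<Rightarrow> real^'m) \<Rightarrow> ('i \<Rightarrow> real^'t^'n) \<Rightarrow> ('i \<Rightarrow> real^'n) \<Rightarrow>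
     ((real^'t^'i) \<times> (real^'t^'i)) set" where
  "joint_feasible_set G H h A b =
     {(q, u). \<forall>i. (q $ i, u $ i) \<in> feasible_set (G i) (H i) (h i) (A i) (b i)}"

text \<open>Producer \<open>i\<close>'s objective at the own decision \<open>(x, w)\<close>, given the others' quantities in \<open>q\<close>;
  the \<open>i\<close>-th row of \<open>q\<close> is irrelevant.\<close>

definition profit ::
    "('i \<Rightarrow> 't \<Rightarrow> real^'i \<Rightarrow> real) \<Rightarrow> ('i \<Rightarrow> real \<Rightarrow> real) \<Rightarrow> ('i \<Rightarrow> real^'t \<Rightarrow> real) \<Rightarrow>
     'i \<Rightarrow> real^'t^'i \<Rightarrow> (real^'t) \<times> (real^'t) \<Rightarrow> real" where
  "profit P C S i q = (\<lambda>(x, w).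
     (\<Sum>t\<in>UNIV. P i t (replace_comp (period q t) i (x $ t))) - (\<Sum>t\<in>UNIV. C i (x $ t)) - S i w)"

definition optimal_solution :: "('a \<Rightarrow> real) \<Rightarrow> 'a set \<Rightarrow> 'a \<Rightarrow> bool" where
  "optimal_solution f X z \<longleftrightarrow> z \<in> X \<and> (\<forall>y\<in>X. f y \<le> f z)"

definition uc_nash_equilibrium ::
    "('i \<Rightarrow> 't \<Rightarrow> real^'i \<Rightarrow> real) \<Rightarrow> ('i \<Rightarrow> real \<Rightarrow> real) \<Rightarrow> ('i \<Rightarrow> real^'t \<Rightarrow> real) \<Rightarrow>
     ('i \<Rightarrow> real^'t^'m) \<Rightarrow> ('i \<Rightarrow> real^'t^'m) \<Rightarrow> ('i \<Rightarrow> real^'m) \<Rightarrow> ('i \<Rightarrow> real^'t^'n) \<Rightarrow> ('i \<Rightarrow> real^'n) \<Rightarrow>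
     real^'t^'i \<Rightarrow> real^'t^'i \<Rightarrow> bool" where
  "uc_nash_equilibrium P C S G H h A b q u \<longleftrightarrow>
     (\<forall>i. optimal_solution (profit P C S i q)
            (feasible_set (G i) (H i) (h i) (A i) (b i)) (q $ i, u $ i))"

end

theory Submission
  imports Defs
begin

text \<open>
  The separable terms \<open>C\<close> and \<open>S\<close> turn the period potentials \<open>F t\<close> into an exact potential of the
  whole game: a unilateral deviation changes the deviator's profit and the potential by the same
  amount.  The joint feasible set is a product over the producers, so unilateral feasible
  deviations stay in it, and it is compact; a maximiser of the potential is therefore an
  equilibrium.
\<close>

text \<open>A unilateral deviation of a producer changes its decisions in all periods at once, while
  \<open>replace_comp\<close> acts within a single period. Polymorphic entries let one operation
  serve whole rows of both \<open>q\<close> and \<open>u\<close>.\<close>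

definition replace_row :: "'a^'i \<Rightarrow> 'i \<Rightarrow> 'a \<Rightarrow> 'a^'i" where
  "replace_row q i x = (\<chi> k. if k = i then x else q $ k)"

lemma replace_row_nth: "replace_row q i x $ k = (if k = i then x else q $ k)"
  by (simp add: replace_row_def)

text \<open>Links the two kinds of replacement: the potential property is stated period by period
  with \<open>replace_comp\<close>, and this carries it over to a deviation of a whole row.\<close>

lemma period_replace_row:
  "period (replace_row q i x) t = replace_comp (period q t) i (x $ t)"
  by (simp add: vec_eq_iff period_def replace_comp_def replace_row_nth)

text \<open>\<open>profit\<close> reads even the current decision through
  \<open>replace_comp\<close>; this removes the trivial replacement when \<open>profit\<close> is
  evaluated at the producer's own row.\<close>

lemma replace_comp_period: "replace_comp (period q t) i (q $ i $ t) = period q t"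
  by (simp add: vec_eq_iff period_def replace_comp_def)

lemma sum_replace_row:
  fixes f :: "'i::finite \<Rightarrow> 'a \<Rightarrow> real"
  shows "(\<Sum>k\<in>UNIV. f k (replace_row q i x $ k)) = (\<Sum>k\<in>UNIV. f k (q $ k)) - f i (q $ i) + f i x"
proof -
  have "(\<Sum>k\<in>UNIV - {i}. f k (replace_row q i x $ k)) = (\<Sum>k\<in>UNIV - {i}. f k (q $ k))"
    by (rule sum.cong) (auto simp: replace_row_nth)
  then show ?thesis
    by (simp add: sum.remove[of UNIV i] replace_row_nth)
qed

lemma continuous_on_period: "continuous_on X (\<lambda>q. period q t)"
  unfolding period_def by (intro continuous_intros)

lemma continuously_differentiable_imp_continuous_on:
  assumes "continuously_differentiable f"
  shows "continuous_on X f"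
  using assms unfolding continuously_differentiable_def
  by (meson continuous_at_imp_continuous_on has_derivative_continuous)

lemma closed_feasible_set:
  fixes G H :: "real^'t::finite^'m::finite" and A :: "real^'t^'n::finite"
  shows "closed (feasible_set G H h A b)"
proof -
  \<comment> \<open>Coordinatewise, the set is cut out by weak inequalities between continuous
    functions and, for the binary variables, by disjunctions of two equations. Each of these
    conditions is closed, integrality included.\<close>
  have "feasible_set G H h A b =
      {z. \<forall>j. (G *v fst z + H *v snd z) $ j \<le> h $ j} \<inter> {z. \<forall>j. (A *v snd z) $ j \<le> b $ j} \<inter>
      {z. \<forall>t. snd z $ t = 0 \<or> snd z $ t = 1}"
    by (auto simp: feasible_set_def less_eq_vec_def)
  also have "closed \<dots>"
    by (intro closed_Int closed_Collect_all closed_Collect_disj closed_Collect_le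
        closed_Collect_eq continuous_intros
        bounded_linear.continuous_on[OF matrix_vector_mul_bounded_linear])
  finally show ?thesis .
qed

lemma closed_joint_feasible_set:
  fixes G H :: "'i::finite \<Rightarrow> real^'t::finite^'m::finite" and A :: "'i \<Rightarrow> real^'t^'n::finite"
  shows "closed (joint_feasible_set G H h A b)"
proof -
  \<comment> \<open>Each producer's constraints involve only its own rows, so the joint set is an
    intersection of preimages of closed sets under continuous projections.\<close>
  have "joint_feasible_set G H h A b =
      (\<Inter>i. (\<lambda>z. (fst z $ i, snd z $ i)) -` feasible_set (G i) (H i) (h i) (A i) (b i))"
    by (auto simp: joint_feasible_set_def)
  also have "closed \<dots>"
    by (intro closed_INT ballI closed_vimage closed_feasible_set continuous_intros)
  finally show ?thesis .
qed

lemma joint_feasible_set_replace_row: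
  assumes "(q, u) \<in> joint_feasible_set G H h A b"
    and "(x, w) \<in> feasible_set (G i) (H i) (h i) (A i) (b i)"
  shows "(replace_row q i x, replace_row u i w) \<in> joint_feasible_set G H h A b"
  using assms by (auto simp: joint_feasible_set_def replace_row_nth)

definition potential ::
    "('t \<Rightarrow> real^'i \<Rightarrow> real) \<Rightarrow> ('i \<Rightarrow> real \<Rightarrow> real) \<Rightarrow> ('i \<Rightarrow> real^'t \<Rightarrow> real) \<Rightarrow>
     (real^'t^'i) \<times> (real^'t^'i) \<Rightarrow> real" where
  "potential F C S = (\<lambda>(q, u).
     (\<Sum>t\<in>UNIV. F t (period q t)) - (\<Sum>i\<in>UNIV. \<Sum>t\<in>UNIV. C i (q $ i $ t)) - (\<Sum>i\<in>UNIV. S i (u $ i)))"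

lemma continuous_on_potential:
  fixes F :: "'t::finite \<Rightarrow> real^'i::finite \<Rightarrow> real"
  assumes "\<And>t. continuous_on UNIV (F t)"
    and "\<And>i. continuous_on UNIV (C i)"
    and "\<And>i. continuous_on UNIV (S i)"
  shows "continuous_on X (potential F C S)"
  unfolding potential_def case_prod_beta
  by (intro continuous_intros continuous_on_compose2[OF assms(1)] continuous_on_compose2[OF assms(2)]
      continuous_on_compose2[OF assms(3)] continuous_on_compose2[OF continuous_on_period[of UNIV]])
    auto

lemma profit_diff_eq_potential_diff:
  fixes F :: "'t::finite \<Rightarrow> real^'i::finite \<Rightarrow> real"
  assumes "\<And>t v x. F t v - F t (replace_comp v i x) = P i t v - P i t (replace_comp v i x)"
  shows "profit P C S i q (q $ i, u $ i) - profit P C S i q (x, w) =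
    potential F C S (q, u) - potential F C S (replace_row q i x, replace_row u i w)"
proof -
  \<comment> \<open>The hypothesis is applied in each period with \<open>v\<close> the current
    period vector and \<open>x $ t\<close> as the deviation, then summed over the periods.\<close>
  have "(\<Sum>t\<in>UNIV. F t (period q t)) - (\<Sum>t\<in>UNIV. F t (period (replace_row q i x) t)) =
      (\<Sum>t\<in>UNIV. P i t (period q t)) - (\<Sum>t\<in>UNIV. P i t (replace_comp (period q t) i (x $ t)))"
    by (simp only: sum_subtractf[symmetric] period_replace_row assms)
  \<comment> \<open>The summand of producer \<open>k\<close> is the cost of its entire row; the
    costs of all producers other than \<open>i\<close> cancel in the difference of
    potentials.\<close>
  moreover have "(\<Sum>k\<in>UNIV. \<Sum>t\<in>UNIV. C k (replace_row q i x $ k $ t)) =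
      (\<Sum>k\<in>UNIV. \<Sum>t\<in>UNIV. C k (q $ k $ t)) - (\<Sum>t\<in>UNIV. C i (q $ i $ t)) + (\<Sum>t\<in>UNIV. C i (x $ t))"
    by (rule sum_replace_row[of "\<lambda>k y. \<Sum>t\<in>UNIV. C k (y $ t)"])
  moreover have "(\<Sum>k\<in>UNIV. S k (replace_row u i w $ k)) =
      (\<Sum>k\<in>UNIV. S k (u $ k)) - S i (u $ i) + S i w"
    by (rule sum_replace_row)
  ultimately show ?thesis
    by (simp add: profit_def potential_def replace_comp_period)
qed

theorem corollary1:
  fixes P :: "'i::finite \<Rightarrow> 't::finite \<Rightarrow> real^'i \<Rightarrow> real"
    and C :: "'i \<Rightarrow> real \<Rightarrow> real"
    and S :: "'i \<Rightarrow> real^'t \<Rightarrow> real"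
    and G H :: "'i \<Rightarrow> real^'t^'m::finite"
    and h :: "'i \<Rightarrow> real^'m"
    and A :: "'i \<Rightarrow> real^'t^'n::finite"
    and b :: "'i \<Rightarrow> real^'n"
  assumes P_concave: "\<And>i t v. concave_on UNIV (\<lambda>x. P i t (replace_comp v i x))"
    and P_C1: "\<And>i t v. (\<lambda>x. P i t (replace_comp v i x)) C1_differentiable_on UNIV"
    and C_convex: "\<And>i. convex_on UNIV (C i)"
    and C_C1: "\<And>i. C i C1_differentiable_on UNIV"
    and S_cont: "\<And>i. continuous_on UNIV (S i)"
    and nonempty: "joint_feasible_set G H h A b \<noteq> {}"
    and bdd: "bounded (joint_feasible_set G H h A b)"
    and potential: "\<exists>F :: 't \<Rightarrow> real^'i \<Rightarrow> real.
      (\<forall>t. concave_on UNIV (F t) \<and> continuously_differentiable (F t)) \<and>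
      (\<forall>t i v x. F t v - F t (replace_comp v i x) = P i t v - P i t (replace_comp v i x))"
  shows "\<exists>q u. uc_nash_equilibrium P C S G H h A b q u"
proof -
  from potential obtain F :: "'t \<Rightarrow> real^'i \<Rightarrow> real"
    where F_C1: "\<And>t. continuously_differentiable (F t)"
      and F: "\<And>t i v x. F t v - F t (replace_comp v i x) = P i t v - P i t (replace_comp v i x)"
    by blast
  have "compact (joint_feasible_set G H h A b)"
    using bdd closed_joint_feasible_set by (simp add: compact_eq_bounded_closed)
  moreover have "continuous_on (joint_feasible_set G H h A b) (potential F C S)"
    by (intro continuous_on_potential continuously_differentiable_imp_continuous_on F_C1
        C1_differentiable_imp_continuous_on C_C1 S_cont)
  \<comment> \<open>Weierstrass on a nonempty compact set. Integrality sits in the set, so discrete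
    and continuous variables are maximised over together.\<close>
  ultimately obtain q u where qu: "(q, u) \<in> joint_feasible_set G H h A b"
    and max: "\<And>z. z \<in> joint_feasible_set G H h A b \<Longrightarrow> potential F C S z \<le> potential F C S (q, u)"
    using continuous_attains_sup[OF _ nonempty] by (metis surj_pair)
  have "optimal_solution (profit P C S i q)
      (feasible_set (G i) (H i) (h i) (A i) (b i)) (q $ i, u $ i)" for i
    unfolding optimal_solution_def
  proof (intro conjI ballI)
    show "(q $ i, u $ i) \<in> feasible_set (G i) (H i) (h i) (A i) (b i)"
      using qu by (simp add: joint_feasible_set_def)
  next
    fix y
    assume y: "y \<in> feasible_set (G i) (H i) (h i) (A i) (b i)"
    obtain x w where [simp]: "y = (x, w)"
      by (cases y)
    have "potential F C S (replace_row q i x, replace_row u i w) \<le> potential F C S (q, u)"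
      using y by (intro max joint_feasible_set_replace_row qu) simp
    \<comment> \<open>The profit lost by deviating equals the drop in potential, which is
      nonnegative at the maximiser.\<close>
    then show "profit P C S i q y \<le> profit P C S i q (q $ i, u $ i)"
      using profit_diff_eq_potential_diff[of F i P C S q u x w, OF F] by simp
  qed
  then show ?thesis
    unfolding uc_nash_equilibrium_def by blast
qed

end
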